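(* For every odd $k\ge 5$ and all sufficiently large $n$ (depending on $k$), $\mathrm{st}(n,C_k)=\mathrm{ex}(n,C_k)=\mathrm{ex}(n,K_3)$.
   Context: Graphs are finite and simple; $C_k$ is the cycle on $k$ vertices. $\mathrm{ex}(n,G)$ is the maximum number of edges of a graph on $n$ vertices containing no (not necessarily induced) copy of $G$. For a non-complete graph $G$ on $k$ vertices and $n\ge k$, $\mathrm{st}(n,G)$ is the largest $m$ for which there is a graph $H$ with $n$ vertices and $m$ edges such that no subgraph $F\subseteq H$ on exactly $k$ vertices contains $G$ as a proper subgraph. *)

theory Defs
  imports Main "HOL-Library.Ramsey"
begin

datatype 'a ugraph = UGraph (verts: "'a set") (edges: "'a set set")

definition simple_graph :: "'a ugraph \<Rightarrow> bool" where
  "simple_graph G \<longleftrightarrow> finite (verts G) \<and> edges G \<subseteq> nsets (verts G) 2"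

text \<open>Subgraphs need not be induced or spanning.\<close>

definition subgraph :: "'a ugraph \<Rightarrow> 'a ugraph \<Rightarrow> bool" where
  "subgraph F H \<longleftrightarrow> simple_graph F \<and> verts F \<subseteq> verts H \<and> edges F \<subseteq> edges H"

definition proper_subgraph :: "'a ugraph \<Rightarrow> 'a ugraph \<Rightarrow> bool" where
  "proper_subgraph F H \<longleftrightarrow> subgraph F H \<and> F \<noteq> H"

definition isomorphic :: "'a ugraph \<Rightarrow> 'b ugraph \<Rightarrow> bool" where
  "isomorphic G H \<longleftrightarrow>
     (\<exists>f. bij_betw f (verts G) (verts H) \<and> edges H = (\<lambda>e. f ` e) ` edges G)"

definition contains_copy :: "'a ugraph \<Rightarrow> 'b ugraph \<Rightarrow> bool" where
  "contains_copy H G \<longleftrightarrow> (\<exists>G'. isomorphic G G' \<and> subgraph G' H)"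

definition contains_proper_copy :: "'a ugraph \<Rightarrow> 'b ugraph \<Rightarrow> bool" where
  "contains_proper_copy H G \<longleftrightarrow> (\<exists>G'. isomorphic G G' \<and> proper_subgraph G' H)"

definition cycle_graph :: "nat \<Rightarrow> nat ugraph" where
  "cycle_graph k = UGraph {..<k} ((\<lambda>i. {i, Suc i mod k}) ` {..<k})"

definition complete_graph :: "nat \<Rightarrow> nat ugraph" where
  "complete_graph r = UGraph {..<r} (nsets {..<r} 2)"

text \<open>Host graphs are taken with vertices in \<^typ>\<open>nat\<close>, which represents every
  finite graph up to isomorphism. The maxima below are over finite sets
  which are nonempty as soon as \<^term>\<open>G\<close> has an edge (shown below).\<close>

definition ex_num :: "nat \<Rightarrow> 'b ugraph \<Rightarrow> nat" where
  "ex_num n G = Max {card (edges H) | H :: nat ugraph.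
     simple_graph H \<and> card (verts H) = n \<and> \<not> contains_copy H G}"

text \<open>A subgraph on exactly as many vertices as \<^term>\<open>G\<close> that contains a copy of
  \<^term>\<open>G\<close> properly has the same vertex set as the copy and at least one more edge.
  The notion is meant for non-complete \<^term>\<open>G\<close> and \<open>n \<ge> card (verts G)\<close>.\<close>

definition st_num :: "nat \<Rightarrow> 'b ugraph \<Rightarrow> nat" where
  "st_num n G = Max {card (edges H) | H :: nat ugraph.
     simple_graph H \<and> card (verts H) = n \<and>
     (\<forall>F. subgraph F H \<and> card (verts F) = card (verts G) \<longrightarrow> \<not> contains_proper_copy F G)}"

lemma simple_graph_cycle_graph:
  assumes "k \<ge> 3"
  shows "simple_graph (cycle_graph k)"
proof -
  have "i \<noteq> Suc i mod k" if "i < k" for i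
    using assms that by (cases "Suc i = k") auto
  then show ?thesis
    using assms by (fastforce simp: simple_graph_def cycle_graph_def nsets_def card_2_iff)
qed

lemma simple_graph_complete_graph: "simple_graph (complete_graph r)"
  by (simp add: simple_graph_def complete_graph_def)

lemma card_edges_le:
  assumes "simple_graph H"
  shows "card (edges H) \<le> card (verts H) choose 2"
  using assms card_mono[of "nsets (verts H) 2" "edges H"]
  by (simp add: simple_graph_def finite_imp_finite_nsets card_nsets)

lemma finite_edge_counts:
  "finite {card (edges H) | H :: nat ugraph. simple_graph H \<and> card (verts H) = n \<and> P H}"
  by (rule finite_subset[of _ "{..n choose 2}"]) (auto dest: card_edges_le)

lemma edge_counts_ex_nonempty:
  assumes "edges G \<noteq> {}"
  shows "{card (edges H) | H :: nat ugraph.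
     simple_graph H \<and> card (verts H) = n \<and> \<not> contains_copy H G} \<noteq> {}"
proof -
  have "simple_graph (UGraph {..<n} {}) \<and> card (verts (UGraph {..<n} {})) = n \<and>
      \<not> contains_copy (UGraph {..<n} {}) G"
    using assms by (auto simp: simple_graph_def contains_copy_def isomorphic_def subgraph_def)
  then show ?thesis by blast
qed

lemma edge_counts_st_nonempty:
  assumes "edges G \<noteq> {}"
  shows "{card (edges H) | H :: nat ugraph.
     simple_graph H \<and> card (verts H) = n \<and>
     (\<forall>F. subgraph F H \<and> card (verts F) = card (verts G) \<longrightarrow> \<not> contains_proper_copy F G)} \<noteq> {}"
proof -
  have "simple_graph (UGraph {..<n} {}) \<and> card (verts (UGraph {..<n} {})) = n \<and>
      (\<forall>F. subgraph F (UGraph {..<n} {}) \<and> card (verts F) = card (verts G) \<longrightarrow>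
        \<not> contains_proper_copy F G)"
    using assms
    by (auto simp: simple_graph_def contains_proper_copy_def isomorphic_def proper_subgraph_def
        subgraph_def)
  then show ?thesis by blast
qed

end

theory Submission
  imports Defs
begin

text \<open>For large \<open>n\<close> all three numbers equal \<open>\<lfloor>n\<^sup>2 / 4\<rfloor>\<close>. The balanced complete bipartite graph contains no odd
  cycle, and \<open>K\<^sub>3 = C\<^sub>3\<close>, so it gives all the lower bounds; Mantel's theorem is the upper bound
  for the triangle. Every \<open>C\<^sub>k\<close>-free graph is admissible for \<open>st_num\<close>, so it remains to show that a
  large graph with more than \<open>n\<^sup>2 / 4\<close> edges contains, for \<open>k = 2 * m + 1\<close>, a \<open>k\<close>-cycle
  together with a chord (\<open>dense_imp_chorded_odd_cycle\<close>).

  Choose a vertex set \<open>S\<close>, of size \<open>s\<close>, maximising \<open>5 e(S) - s\<^sup>2\<close>. Then \<open>s \<ge> n / 5\<close>, there are still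
  more than \<open>s\<^sup>2 / 4\<close> edges inside \<open>S\<close>, and every degree inside \<open>S\<close> is at least \<open>(2 s - 1) / 5\<close>
  (\<open>dense_subset_with_large_degrees\<close>). Three sets of this size cannot be nearly disjoint,
  so among any three vertices of \<open>S\<close> two have linearly many common neighbours
  (\<open>large_codegree_among_three\<close>). This fact is used twice. Applied to a triangle, which exists
  by Mantel's theorem inside \<open>S\<close>, it gives an edge \<open>u v\<close> with a large common neighbourhood \<open>W\<close>. Applied to
  triples in \<open>W\<close>, it says that the relation of having many common neighbours has no independent
  triple in \<open>W\<close>, hence has a clique \<open>w\<^sub>0, \<dots>, w\<^bsub>m-1\<^esub>\<close> (\<open>clique_if_no_three_independent\<close>).
  Choosing distinct further common neighbours \<open>z\<^sub>i\<close> of \<open>w\<^sub>i\<close> and \<open>w\<^bsub>i+1\<^esub>\<close> yields the cycle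
  \<open>v u w\<^sub>0 z\<^sub>0 w\<^sub>1 \<dots> z\<^bsub>m-2\<^esub> w\<^bsub>m-1\<^esub>\<close> of length \<open>2 m + 1\<close>, and \<open>v w\<^sub>0\<close> is a chord because \<open>m \<ge> 2\<close>.\<close>

section \<open>Neighbourhoods and spanned edges\<close>

text \<open>Throughout, a graph is given by a set \<open>E\<close> of two-element edges; \<open>S\<close> selects the induced
  subgraph under consideration. This is the set of neighbours of \<open>v\<close> inside \<open>S\<close>.\<close>

definition nbhd :: "'a set set \<Rightarrow> 'a set \<Rightarrow> 'a \<Rightarrow> 'a set" where
  "nbhd E S v = {w \<in> S. {v, w} \<in> E}"

text \<open>The edges of the subgraph induced by \<open>S\<close>.\<close>

definition spanned :: "'a set set \<Rightarrow> 'a set \<Rightarrow> 'a set set" where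
  "spanned E S = {e \<in> E. e \<subseteq> S}"

lemma nbhd_subset: "nbhd E S v \<subseteq> S"
  by (auto simp: nbhd_def)

lemma edge_neq: "\<forall>e\<in>E. card e = 2 \<Longrightarrow> {u, v} \<in> E \<Longrightarrow> u \<noteq> v"
  by force

lemma finite_spanned: "finite S \<Longrightarrow> finite (spanned E S)"
  by (rule finite_subset[of _ "Pow S"]) (auto simp: spanned_def)

lemma card_spanned_remove:
  assumes "finite S" "v \<in> S" and E: "\<forall>e\<in>E. card e = 2"
  shows "card (spanned E S) = card (spanned E (S - {v})) + card (nbhd E S v)"
proof -
  have "spanned E S = spanned E (S - {v}) \<union> (\<lambda>w. {v, w}) ` nbhd E S v"
  proof (rule set_eqI)
    fix e
    show "e \<in> spanned E S \<longleftrightarrow> e \<in> spanned E (S - {v}) \<union> (\<lambda>w. {v, w}) ` nbhd E S v"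
    proof (cases "e \<in> E \<and> v \<in> e")
      case True
      then obtain w where "e = {v, w}"
        using E by (metis card_2_iff insert_commute insertE singletonD)
      then show ?thesis
        using True \<open>v \<in> S\<close> by (auto simp: spanned_def nbhd_def doubleton_eq_iff)
    next
      case False
      then show ?thesis
        by (auto simp: spanned_def nbhd_def)
    qed
  qed
  moreover have "spanned E (S - {v}) \<inter> (\<lambda>w. {v, w}) ` nbhd E S v = {}"
    by (auto simp: spanned_def)
  moreover have "inj_on (\<lambda>w. {v, w}) (nbhd E S v)"
    by (auto simp: inj_on_def doubleton_eq_iff)
  ultimately show ?thesis
    using \<open>finite S\<close> by (simp add: card_Un_disjoint finite_spanned nbhd_def card_image)
qed

text \<open>A crude bound, used only to keep the subset chosen below from being small.\<close>

lemma card_spanned_le: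
  assumes "finite S" and E: "\<forall>e\<in>E. card e = 2"
  shows "card (spanned E S) \<le> card S * card S"
  using \<open>finite S\<close>
proof (induction "card S" arbitrary: S)
  case 0
  then have "spanned E S = {}"
    using E by (force simp: spanned_def)
  then show ?case by simp
next
  case (Suc n)
  then obtain v where v: "v \<in> S"
    by fastforce
  have n: "card (S - {v}) = n"
    using Suc v by simp
  have "card (nbhd E S v) \<le> card S"
    by (simp add: Suc.prems card_mono nbhd_subset)
  moreover have "card (spanned E (S - {v})) \<le> n * n"
    using Suc n by (metis finite_Diff)
  ultimately show ?case
    using card_spanned_remove[OF Suc.prems v E] Suc.hyps(2)[symmetric] by simp
qed

section \<open>Triangles and common neighbours\<close>

text \<open>Mantel's theorem: the two ends of an edge in a triangle-free graph have disjoint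
  neighbourhoods, so deleting both ends destroys fewer than \<open>card S\<close> edges.\<close>

lemma mantel:
  assumes "finite S" and E: "\<forall>e\<in>E. card e = 2"
    and no_triangle: "\<And>u v w. \<lbrakk>u \<in> S; v \<in> S; w \<in> S; {u, v} \<in> E; {u, w} \<in> E; {v, w} \<in> E\<rbrakk> \<Longrightarrow> False"
  shows "4 * card (spanned E S) \<le> (card S)\<^sup>2"
  using \<open>finite S\<close> no_triangle
proof (induction "card S" arbitrary: S rule: less_induct)
  case less
  show ?case
  proof (cases "spanned E S = {}")
    case False
    then obtain e where e: "e \<in> E" "e \<subseteq> S"
      by (auto simp: spanned_def)
    then obtain u v where uv: "e = {u, v}" "u \<noteq> v"
      using E by (metis card_2_iff)
    define T where "T = S - {u} - {v}"
    have mem: "u \<in> S" "v \<in> S - {u}" and uvE: "{u, v} \<in> E"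
      using e uv by auto
    have cardS: "card S = card T + 2"
      using mem less.prems(1) unfolding T_def
      by (metis Suc_eq_plus1 Suc_1 add.assoc add.commute card_Suc_Diff1 finite_Diff plus_1_eq_Suc)
    have IH: "4 * card (spanned E T) \<le> (card T)\<^sup>2"
      using less.prems by (intro less.hyps) (auto simp: cardS, auto simp: T_def)
    have "nbhd E S u \<inter> nbhd E (S - {u}) v = {}"
      using less.prems(2)[of u v] mem uvE by (auto simp: nbhd_def)
    moreover have "nbhd E S u \<union> nbhd E (S - {u}) v \<subseteq> S - {u}"
      using E by (force simp: nbhd_def)
    ultimately have "card (nbhd E S u) + card (nbhd E (S - {u}) v) \<le> card (S - {u})"
      using less.prems(1)
      by (metis card_Un_disjoint card_mono finite_Diff finite_subset nbhd_subset)
    then have "card (nbhd E S u) + card (nbhd E (S - {u}) v) \<le> card T + 1"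
      using cardS mem less.prems(1) by simp
    moreover have "card (spanned E S) =
        card (spanned E T) + card (nbhd E (S - {u}) v) + card (nbhd E S u)"
      using card_spanned_remove[OF less.prems(1) mem(1) E]
        card_spanned_remove[OF _ mem(2) E] less.prems(1) by (simp add: T_def)
    ultimately show ?thesis
      using IH by (simp add: cardS power2_eq_square)
  qed simp
qed

lemma card_three_sets_le:
  assumes "finite S" "A \<subseteq> S" "B \<subseteq> S" "C \<subseteq> S"
  shows "card A + card B + card C \<le> card S + card (A \<inter> B) + card (A \<inter> C) + card (B \<inter> C)"
proof -
  have fin: "finite A" "finite B" "finite C"
    using assms by (auto intro: finite_subset)
  have "card A + card B = card (A \<union> B) + card (A \<inter> B)"
    using fin by (intro card_Un_Int)
  moreover have "card (A \<union> B) + card C = card (A \<union> B \<union> C) + card ((A \<union> B) \<inter> C)"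
    using fin by (intro card_Un_Int) auto
  moreover have "card ((A \<union> B) \<inter> C) \<le> card (A \<inter> C) + card (B \<inter> C)"
    by (metis Int_Un_distrib2 card_Un_le)
  moreover have "card (A \<union> B \<union> C) \<le> card S"
    using assms by (intro card_mono) auto
  ultimately show ?thesis by linarith
qed

text \<open>The degrees of three vertices add up to about \<open>6/5\<close> of \<open>card S\<close>, so the three pairwise
  intersections of the neighbourhoods together have size at least about \<open>1/5\<close> of it.\<close>

lemma large_codegree_among_three:
  assumes "finite S" and s: "card S > 15 * t + 3"
    and deg: "\<And>v. v \<in> S \<Longrightarrow> 2 * card S \<le> 5 * card (nbhd E S v) + 1"
    and "u \<in> S" "v \<in> S" "w \<in> S"
  shows "card (nbhd E S u \<inter> nbhd E S v) > t \<or> card (nbhd E S u \<inter> nbhd E S w) > t \<or>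
    card (nbhd E S v \<inter> nbhd E S w) > t"
  using card_three_sets_le[OF \<open>finite S\<close> nbhd_subset nbhd_subset nbhd_subset, of E u E v E w]
    deg[OF \<open>u \<in> S\<close>] deg[OF \<open>v \<in> S\<close>] deg[OF \<open>w \<in> S\<close>] s
  by linarith

text \<open>A subset \<open>S\<close> maximising \<open>5 * card (spanned E S) - (card S)\<^sup>2\<close> has large minimum degree, since
  deleting a vertex does not increase this quantity. At \<open>V\<close> its value exceeds \<open>(card V)\<^sup>2 / 4\<close>,
  hence so does the maximum; this bounds \<open>card S\<close> from below, and \<open>(card V)\<^sup>2 \<ge> (card S)\<^sup>2\<close> turns it
  into the edge density of \<open>S\<close>.\<close>

lemma dense_subset_with_large_degrees:
  assumes "finite V" and E: "\<forall>e\<in>E. card e = 2"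
    and dense: "4 * card (spanned E V) > (card V)\<^sup>2"
  obtains S where "S \<subseteq> V" "4 * card (spanned E S) > (card S)\<^sup>2" "card V \<le> 5 * card S"
    "\<And>v. v \<in> S \<Longrightarrow> 2 * card S \<le> 5 * card (nbhd E S v) + 1"
proof -
  define \<phi> where "\<phi> S = 5 * int (card (spanned E S)) - (int (card S))\<^sup>2" for S
  have "Max (\<phi> ` Pow V) \<in> \<phi> ` Pow V"
    using \<open>finite V\<close> by (intro Max_in) auto
  then obtain S where S: "S \<subseteq> V" "\<phi> S = Max (\<phi> ` Pow V)"
    by auto
  have max: "\<phi> T \<le> \<phi> S" if "T \<subseteq> V" for T
    using \<open>finite V\<close> that S by simp
  have fin: "finite S"
    using S \<open>finite V\<close> finite_subset by auto
  have le: "(int (card S))\<^sup>2 \<le> (int (card V))\<^sup>2"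
    using S \<open>finite V\<close> by (intro power_mono) (auto simp: card_mono)
  have "4 * int (card (spanned E V)) > (int (card V))\<^sup>2"
    using dense by (metis of_nat_less_iff of_nat_mult of_nat_numeral of_nat_power)
  then have "4 * \<phi> S > (int (card V))\<^sup>2"
    using max[of V] unfolding \<phi>_def by simp
  then have \<phi>: "(int (card V))\<^sup>2 + 4 * (int (card S))\<^sup>2 < 20 * int (card (spanned E S))"
    unfolding \<phi>_def by simp
  have "4 * int (card (spanned E S)) > (int (card S))\<^sup>2"
    using \<phi> le by linarith
  then have 1: "4 * card (spanned E S) > (card S)\<^sup>2"
    by (metis of_nat_less_iff of_nat_mult of_nat_numeral of_nat_power)
  have "int (card (spanned E S)) \<le> (int (card S))\<^sup>2"
    using card_spanned_le[OF fin E]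
    by (metis of_nat_le_iff of_nat_mult power2_eq_square)
  then have "(int (card V))\<^sup>2 \<le> 25 * (int (card S))\<^sup>2"
    using \<phi> le by linarith
  then have "(int (card V))\<^sup>2 \<le> (int (5 * card S))\<^sup>2"
    by (simp add: power_mult_distrib)
  then have 2: "card V \<le> 5 * card S"
    by (metis of_nat_0_le_iff of_nat_le_iff power2_le_imp_le)
  have 3: "2 * card S \<le> 5 * card (nbhd E S v) + 1" if v: "v \<in> S" for v
  proof -
    have "int (card S) = int (card (S - {v})) + 1"
      using v fin by (metis card_Suc_Diff1 int_Suc)
    moreover have "\<phi> (S - {v}) \<le> \<phi> S"
      using S by (intro max) auto
    ultimately show ?thesis
      using card_spanned_remove[OF fin v E]
      by (simp add: \<phi>_def power2_eq_square algebra_simps)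
  qed
  show thesis
    using that[OF S(1) 1 2 3] by blast
qed

section \<open>Cliques in dense relations and systems of distinct representatives\<close>

text \<open>The points not related to a given one are pairwise related; if there are fewer than \<open>m\<close>
  of them, one continues among the many related points.\<close>

lemma clique_if_no_three_independent:
  assumes "finite W" "m\<^sup>2 \<le> card W"
    and sym: "\<And>x y. R x y \<Longrightarrow> R y x"
    and three: "\<And>x y z. \<lbrakk>x \<in> W; y \<in> W; z \<in> W; x \<noteq> y; x \<noteq> z; y \<noteq> z\<rbrakk> \<Longrightarrow> R x y \<or> R x z \<or> R y z"
  shows "\<exists>C\<subseteq>W. card C = m \<and> (\<forall>x\<in>C. \<forall>y\<in>C. x \<noteq> y \<longrightarrow> R x y)"
  using assms(1,2) three
proof (induction m arbitrary: W)
  case 0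
  then show ?case by (intro exI[of _ "{}"]) auto
next
  case (Suc m)
  have "card W \<noteq> 0"
    using Suc.prems(2) by (metis le_zero_eq power_eq_0_iff nat.distinct(1))
  then obtain w where w: "w \<in> W"
    by (metis card.empty ex_in_conv)
  define A where "A = {x \<in> W. x \<noteq> w \<and> R w x}"
  define B where "B = {x \<in> W. x \<noteq> w \<and> \<not> R w x}"
  have fin: "finite A" "finite B"
    using Suc.prems(1) by (auto simp: A_def B_def)
  have "W = insert w (A \<union> B)" "w \<notin> A \<union> B" "A \<inter> B = {}"
    using w by (auto simp: A_def B_def)
  then have cardW: "card W = card A + card B + 1"
    using fin by (simp add: card_Un_disjoint)
  show ?case
  proof (cases "card B \<ge> Suc m")
    case True
    then obtain C where C: "C \<subseteq> B" "card C = Suc m"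
      using obtain_subset_with_card_n by metis
    have "R x y" if "x \<in> C" "y \<in> C" "x \<noteq> y" for x y
      using Suc.prems(3)[of w x y] that C w by (auto simp: B_def)
    then show ?thesis
      using C by (intro exI[of _ C]) (auto simp: B_def)
  next
    case False
    then have "m\<^sup>2 \<le> card A"
      using Suc.prems(2) cardW by (simp add: power2_eq_square)
    moreover have "\<And>x y z. \<lbrakk>x \<in> A; y \<in> A; z \<in> A; x \<noteq> y; x \<noteq> z; y \<noteq> z\<rbrakk> \<Longrightarrow> R x y \<or> R x z \<or> R y z"
      using Suc.prems(3) by (simp add: A_def)
    ultimately obtain C where C: "C \<subseteq> A" "card C = m" "\<forall>x\<in>C. \<forall>y\<in>C. x \<noteq> y \<longrightarrow> R x y"
      using Suc.IH[of A] fin by auto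
    have "w \<notin> C" "finite C" "C \<subseteq> W"
      using C fin finite_subset by (auto simp: A_def)
    moreover have "R w x \<and> R x w" if "x \<in> C" for x
      using C that sym by (auto simp: A_def)
    ultimately show ?thesis
      using C w by (intro exI[of _ "insert w C"]) auto
  qed
qed

lemma distinct_representatives:
  fixes A :: "nat \<Rightarrow> 'a set"
  assumes "finite X" and "\<And>i. i < r \<Longrightarrow> card (A i) \<ge> card X + r"
  shows "\<exists>z. inj_on z {..<r} \<and> (\<forall>i<r. z i \<in> A i - X)"
  using assms(2)
proof (induction r)
  case 0
  then show ?case by simp
next
  case (Suc r)
  have "\<And>i. i < r \<Longrightarrow> card X + r \<le> card (A i)"
    using Suc.prems by (metis Suc_leD add_Suc_right less_SucI)
  then obtain z where z: "inj_on z {..<r}" "\<forall>i<r. z i \<in> A i - X"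
    using Suc.IH by blast
  have "card (X \<union> z ` {..<r}) \<le> card X + r"
    by (metis card_Un_le card_image card_lessThan z(1))
  also have "\<dots> < card (A r)"
    using Suc.prems[of r] by simp
  finally have "\<not> A r \<subseteq> X \<union> z ` {..<r}"
    using \<open>finite X\<close> by (meson card_mono finite_UnI finite_imageI finite_lessThan not_le)
  then obtain a where a: "a \<in> A r" "a \<notin> X" "a \<notin> z ` {..<r}"
    by auto
  have "inj_on (z(r := a)) {..<Suc r}"
    using z(1) a(3) by (auto simp: inj_on_def lessThan_Suc)
  moreover have "\<forall>i<Suc r. (z(r := a)) i \<in> A i - X"
    using z(2) a by (auto simp: less_Suc_eq)
  ultimately show ?case by blast
qed

section \<open>An odd cycle with a chord in a dense graph\<close>

text \<open>The cycle is \<open>v, u, w 0, z 0, w 1, z 1, \<dots>, w (m - 1)\<close>, where \<open>u v\<close> is an edge with many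
  common neighbours, the \<open>w i\<close> are common neighbours of \<open>u\<close> and \<open>v\<close> any two of which have many
  common neighbours themselves, and \<open>z i\<close> is a common neighbour of \<open>w i\<close> and \<open>w (Suc i)\<close>.
  The chord joins \<open>v\<close> to \<open>w 0\<close>.\<close>

lemma dense_imp_chorded_odd_cycle:
  assumes "finite V" and E: "\<forall>e\<in>E. card e = 2"
    and dense: "4 * card (spanned E V) > (card V)\<^sup>2"
    and m: "m \<ge> 2" and large: "card V \<ge> 75 * (m\<^sup>2 + 2 * m + 1) + 20"
  obtains f where "inj_on f {..<2 * m + 1}" "f ` {..<2 * m + 1} \<subseteq> V"
    "\<And>i. i < 2 * m + 1 \<Longrightarrow> {f i, f (Suc i mod (2 * m + 1))} \<in> E" "{f 0, f 2} \<in> E"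
proof -
  \<comment> \<open>Enough for a clique of size \<open>m\<close> in \<open>W\<close>, and for \<open>m - 1\<close> representatives that avoid the
    \<open>m + 2\<close> vertices \<open>u\<close>, \<open>v\<close> and \<open>w i\<close>.\<close>
  define t where "t = m\<^sup>2 + 2 * m + 1"
  obtain S where S: "S \<subseteq> V" "4 * card (spanned E S) > (card S)\<^sup>2" "card V \<le> 5 * card S"
    and deg: "\<And>v. v \<in> S \<Longrightarrow> 2 * card S \<le> 5 * card (nbhd E S v) + 1"
    using dense_subset_with_large_degrees[OF \<open>finite V\<close> E dense] by metis
  have fin: "finite S"
    using S \<open>finite V\<close> finite_subset by auto
  have s: "card S > 15 * t + 3"
    using S(3) large by (simp add: t_def)
  note codeg = large_codegree_among_three[OF fin s deg]
  obtain a b c where abc: "a \<in> S" "b \<in> S" "c \<in> S" "{a, b} \<in> E" "{a, c} \<in> E" "{b, c} \<in> E"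
    using mantel[OF fin E] S(2) by (metis not_le)
  then obtain u v where uv: "u \<in> S" "v \<in> S" "{u, v} \<in> E"
    and W: "card (nbhd E S u \<inter> nbhd E S v) > t"
    using codeg[of a b c] by metis
  define W where "W = nbhd E S u \<inter> nbhd E S v"
  define R where "R x y \<longleftrightarrow> card (nbhd E S x \<inter> nbhd E S y) > t" for x y
  have WS: "W \<subseteq> S" "finite W"
    using fin finite_subset by (auto simp: W_def nbhd_def)
  have "\<exists>C\<subseteq>W. card C = m \<and> (\<forall>x\<in>C. \<forall>y\<in>C. x \<noteq> y \<longrightarrow> R x y)"
  proof (rule clique_if_no_three_independent)
    show "finite W" by fact
    show "m\<^sup>2 \<le> card W"
      using W by (simp add: W_def t_def)
    show "R x y \<Longrightarrow> R y x" for x y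
      by (simp add: R_def Int_commute)
    show "R x y \<or> R x z \<or> R y z" if "x \<in> W" "y \<in> W" "z \<in> W" for x y z
      using that WS codeg[of x y z] unfolding R_def by auto
  qed
  then obtain C where C: "C \<subseteq> W" "card C = m" "\<forall>x\<in>C. \<forall>y\<in>C. x \<noteq> y \<longrightarrow> R x y"
    by blast
  have finC: "finite C"
    using C(1) WS finite_subset by auto
  obtain w where w: "bij_betw w {..<m} C"
    using ex_bij_betw_nat_finite[OF finC] C(2) by (auto simp: atLeast0LessThan)
  have wW: "w i \<in> W" if "i < m" for i
    using w C(1) that by (auto simp: bij_betw_def)
  have winj: "w i = w j \<longleftrightarrow> i = j" if "i < m" "j < m" for i j
    using w that by (auto simp: bij_betw_def inj_on_def)
  define X where "X = insert u (insert v C)"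
  define A where "A i = nbhd E S (w i) \<inter> nbhd E S (w (Suc i))" for i
  have "\<exists>z. inj_on z {..<m - 1} \<and> (\<forall>i<m - 1. z i \<in> A i - X)"
  proof (rule distinct_representatives)
    show "finite X"
      using finC by (simp add: X_def)
    fix i assume i: "i < m - 1"
    have "card X \<le> m + 2"
      using C(2) finC by (simp add: X_def card_insert_if)
    moreover have "w i \<noteq> w (Suc i)" "w i \<in> C" "w (Suc i) \<in> C"
      using w i winj[of i "Suc i"] by (auto simp: bij_betw_def)
    then have "card (A i) > t"
      using C(3) by (auto simp: R_def A_def)
    ultimately show "card X + (m - 1) \<le> card (A i)"
      using m by (simp add: t_def)
  qed
  then obtain z where z: "inj_on z {..<m - 1}" "\<And>i. i < m - 1 \<Longrightarrow> z i \<in> A i - X"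
    by blast
  define f where "f i = (if i = 0 then v else if i = 1 then u
     else if even i then w (i div 2 - 1) else z (i div 2 - 1))" for i
  have f: "f 0 = v" "f (Suc 0) = u" "f (2 * i + 2) = w i" "f (2 * i + 3) = z i" for i
    by (simp_all add: f_def)
  \<comment> \<open>Odd positions from \<open>3\<close> on carry the \<open>z j\<close>, even positions from \<open>2\<close> on the \<open>w j\<close>.\<close>
  have cases: "i = 0 \<or> i = Suc 0 \<or> (\<exists>j<m. i = 2 * j + 2) \<or> (\<exists>j<m - 1. i = 2 * j + 3)"
    if "i < 2 * m + 1" for i
    using that by presburger
  have ne: "u \<noteq> v"
    using edge_neq[OF E uv(3)] .
  have wE: "{u, w i} \<in> E" "{v, w i} \<in> E" "w i \<in> S" if "i < m" for i
    using wW[OF that] by (auto simp: W_def nbhd_def)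
  have zE: "{w i, z i} \<in> E" "{w (Suc i), z i} \<in> E" "z i \<in> S" if "i < m - 1" for i
    using z(2)[OF that] by (auto simp: A_def nbhd_def)
  have wne: "w i \<noteq> u" "w i \<noteq> v" if "i < m" for i
    using wE[OF that] edge_neq[OF E] by blast+
  have zne: "z i \<noteq> u" "z i \<noteq> v" if "i < m - 1" for i
    using z(2)[OF that] by (auto simp: X_def)
  have wz: "w j \<noteq> z i" if "i < m - 1" "j < m" for i j
  proof -
    have "w j \<in> C" "z i \<notin> C"
      using z(2)[OF that(1)] w that(2) by (auto simp: X_def bij_betw_def)
    then show ?thesis by auto
  qed
  have zinj: "z i = z j \<longleftrightarrow> i = j" if "i < m - 1" "j < m - 1" for i j
    using z(1) that by (auto simp: inj_on_def)
  have "inj_on f {..<2 * m + 1}"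
  proof (rule inj_onI)
    fix i j assume ij: "i \<in> {..<2 * m + 1}" "j \<in> {..<2 * m + 1}" and eq: "f i = f j"
    show "i = j"
      using cases[of i, OF ij(1)[simplified lessThan_iff]]
        cases[of j, OF ij(2)[simplified lessThan_iff]] eq
      by (elim disjE exE conjE; simp only: f)
        (use ne wne zne wz winj zinj in \<open>metis+\<close>)
  qed
  moreover have "f ` {..<2 * m + 1} \<subseteq> V"
  proof
    fix x assume "x \<in> f ` {..<2 * m + 1}"
    then obtain i where i: "i < 2 * m + 1" and x: "x = f i" by auto
    have "x \<in> S"
      using cases[OF i] unfolding x by (elim disjE exE conjE; simp only: f uv wE(3) zE(3))
    then show "x \<in> V"
      using S(1) by auto
  qed
  moreover have "{f i, f (Suc i mod (2 * m + 1))} \<in> E" if i: "i < 2 * m + 1" for i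
  proof (cases "i = 2 * m")
    case True
    then have "i = 2 * (m - 1) + 2"
      using m by simp
    then have "f i = w (m - 1)" "f (Suc i mod (2 * m + 1)) = v"
      using f(1,3) True by (metis, simp)
    then show ?thesis
      using wE(2)[of "m - 1"] m by (simp add: insert_commute)
  next
    case False
    then have eq: "f (Suc i mod (2 * m + 1)) = f (Suc i)"
      using i by simp
    have "i = 0 \<or> i = Suc 0 \<or> (\<exists>j<m - 1. i = 2 * j + 2) \<or> (\<exists>j<m - 1. i = 2 * j + 3)"
      using i False by presburger
    then consider "i = 0" | "i = Suc 0"
      | j where "j < m - 1" "i = 2 * j + 2" | j where "j < m - 1" "i = 2 * j + 3"
      by blast
    then show ?thesis
    proof cases
      case 1
      then show ?thesis
        unfolding eq using uv(3) f by (simp add: insert_commute)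
    next
      case 2
      then show ?thesis
        unfolding eq using wE(1)[of 0] f(2) f(3)[of 0] m by (simp add: numeral_2_eq_2)
    next
      case 3
      then have "Suc i = 2 * j + 3" by simp
      with 3 show ?thesis
        unfolding eq using zE(1)[of j] f(3,4) by metis
    next
      case 4
      then have "Suc i = 2 * Suc j + 2" by simp
      with 4 show ?thesis
        unfolding eq using zE(2)[of j] f(3,4) by (metis insert_commute)
    qed
  qed
  moreover have "{f 0, f 2} \<in> E"
    using wE(2)[of 0] f(1) f(3)[of 0] m by (simp add: numeral_2_eq_2)
  ultimately show thesis
    using that by blast
qed

lemma dense_imp_proper_copy_of_odd_cycle:
  assumes H: "simple_graph H" and k: "odd k" "k \<ge> 5"
    and dense: "4 * card (edges H) > (card (verts H))\<^sup>2"
    and large: "card (verts H) \<ge> 75 * (k\<^sup>2 + 2 * k + 1) + 20"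
  shows "\<exists>F. subgraph F H \<and> card (verts F) = k \<and> contains_proper_copy F (cycle_graph k)"
proof -
  obtain m where km: "k = 2 * m + 1"
    using \<open>odd k\<close> oddE by blast
  have m: "m \<ge> 2" "m \<le> k"
    using km k by auto
  have E: "\<forall>e\<in>edges H. card e = 2" "\<forall>e\<in>edges H. finite e"
    and fin: "finite (verts H)"
    using H by (auto simp: simple_graph_def nsets_def)
  have "spanned (edges H) (verts H) = edges H"
    using H by (auto simp: simple_graph_def nsets_def spanned_def)
  moreover have "75 * (m\<^sup>2 + 2 * m + 1) + 20 \<le> 75 * (k\<^sup>2 + 2 * k + 1) + 20"
    using m(2) by (intro add_mono mult_mono power_mono) auto
  then have "75 * (m\<^sup>2 + 2 * m + 1) + 20 \<le> card (verts H)"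
    using large by (rule le_trans)
  ultimately obtain f where inj: "inj_on f {..<k}" and fV: "f ` {..<k} \<subseteq> verts H"
    and cyc: "\<And>i. i < k \<Longrightarrow> {f i, f (Suc i mod k)} \<in> edges H" and chord: "{f 0, f 2} \<in> edges H"
    using dense_imp_chorded_odd_cycle[OF fin E(1) _ m(1)] dense unfolding km by metis
  define D where "D = (\<lambda>i. {f i, f (Suc i mod k)}) ` {..<k}"
  define G where "G = UGraph (f ` {..<k}) D"
  define F where "F = UGraph (f ` {..<k}) (insert {f 0, f 2} D)"
  have feq: "f i = f j \<longleftrightarrow> i = j" if "i < k" "j < k" for i j
    using inj that by (auto simp: inj_on_def)
  have "{f 0, f 2} \<notin> D"
  proof
    assume "{f 0, f 2} \<in> D"
    then obtain i where i: "i < k" "{f 0, f 2} = {f i, f (Suc i mod k)}"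
      by (auto simp: D_def)
    have "Suc i mod k < k"
      using k by simp
    then have "i = 0 \<and> Suc i mod k = 2 \<or> i = 2 \<and> Suc i mod k = 0"
      using i k by (auto simp: doubleton_eq_iff feq)
    then show False
      using k by (auto dest: dvd_imp_le)
  qed
  then have neq: "G \<noteq> F"
    by (auto simp: G_def F_def)
  have DH: "D \<subseteq> edges H"
    using cyc by (auto simp: D_def)
  have sub: "insert {f 0, f 2} D \<subseteq> Pow (f ` {..<k})"
    using k by (auto simp: D_def)
  have simple: "simple_graph F" "simple_graph G"
    using sub DH E chord by (auto simp: simple_graph_def F_def G_def nsets_def)
  have "isomorphic (cycle_graph k) G"
    unfolding isomorphic_def
    by (rule exI[of _ f])
      (use inj in \<open>auto simp: cycle_graph_def G_def D_def bij_betw_def image_image\<close>)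
  moreover have "proper_subgraph G F"
    using simple neq by (auto simp: proper_subgraph_def subgraph_def G_def F_def)
  moreover have "subgraph F H"
    using simple fV DH chord by (auto simp: subgraph_def F_def)
  moreover have "card (verts F) = k"
    using inj by (simp add: F_def card_image)
  ultimately show ?thesis
    unfolding contains_proper_copy_def by blast
qed

section \<open>The balanced complete bipartite graph and the three extremal numbers\<close>

lemma complete_graph_3_eq: "complete_graph 3 = cycle_graph 3"
proof -
  have eq: "{..<3} = {0, 1, 2 :: nat}"
    by auto
  have "nsets {0, 1, 2 :: nat} 2 = {{0, 1}, {1, 2}, {2, 0}}"
    by (simp add: nsets_2_eq insert_Diff_if insert_commute)
  then show ?thesis
    by (simp add: complete_graph_def cycle_graph_def eq numeral_2_eq_2)
qed

text \<open>Around a cycle, the side of the bipartition alternates.\<close>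

lemma bipartite_no_odd_cycle:
  assumes c: "\<And>a b. {a, b} \<in> edges H \<Longrightarrow> c a \<noteq> (c b :: bool)" and "odd k"
  shows "\<not> contains_copy H (cycle_graph k)"
proof
  assume "contains_copy H (cycle_graph k)"
  then obtain G f where f: "edges G = (`) f ` edges (cycle_graph k)" and G: "subgraph G H"
    by (auto simp: contains_copy_def isomorphic_def)
  have step: "c (f i) \<noteq> c (f (Suc i mod k))" if "i < k" for i
  proof (rule c)
    have "f ` {i, Suc i mod k} \<in> edges G"
      unfolding f using that by (intro imageI) (simp add: cycle_graph_def)
    then show "{f i, f (Suc i mod k)} \<in> edges H"
      using G by (auto simp: subgraph_def)
  qed
  have alt: "i < k \<Longrightarrow> c (f i) = (c (f 0) = even i)" for i
  proof (induction i)
    case (Suc i)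
    then show ?case
      using step[of i] by auto
  qed simp
  have "k > 0"
    using \<open>odd k\<close> by (cases k) auto
  then have "c (f (k - 1)) = c (f 0)"
    using alt[of "k - 1"] \<open>odd k\<close> by simp
  then show False
    using step[of "k - 1"] \<open>k > 0\<close> by simp
qed

lemma bipartite_extremal_graph:
  obtains H :: "nat ugraph" where "simple_graph H" "card (verts H) = n" "card (edges H) = n\<^sup>2 div 4"
    "\<And>k. odd k \<Longrightarrow> \<not> contains_copy H (cycle_graph k)"
proof -
  define h where "h = n div 2"
  define E where "E = (\<lambda>(a, b). {a, b}) ` ({..<h} \<times> {h..<n})"
  have "inj_on (\<lambda>(a, b). {a, b}) ({..<h} \<times> {h..<n})"
    by (auto simp: inj_on_def doubleton_eq_iff)
  then have "card E = h * (n - h)"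
    unfolding E_def by (simp add: card_image)
  also have "\<dots> = n\<^sup>2 div 4"
  proof (cases "even n")
    case True
    then show ?thesis
      by (auto simp: h_def power2_eq_square elim!: evenE)
  next
    case False
    then obtain j where j: "n = 2 * j + 1"
      using oddE by blast
    then have "n\<^sup>2 = 4 * (j * (j + 1)) + 1"
      by (simp add: power2_eq_square algebra_simps)
    then show ?thesis
      by (simp add: h_def j)
  qed
  finally have "card E = n\<^sup>2 div 4" .
  moreover have "simple_graph (UGraph {..<n} E)"
    by (auto simp: simple_graph_def E_def h_def)
  moreover have "\<not> contains_copy (UGraph {..<n} E) (cycle_graph k)" if "odd k" for k
    by (rule bipartite_no_odd_cycle[where c = "\<lambda>a. a < h", OF _ that])
      (auto simp: E_def doubleton_eq_iff)
  ultimately show thesis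
    using that[of "UGraph {..<n} E"] by simp
qed

lemma contains_copy_of_subgraph_proper:
  assumes "subgraph F H" "contains_proper_copy F G"
  shows "contains_copy H G"
  using assms
  unfolding contains_proper_copy_def contains_copy_def proper_subgraph_def subgraph_def
  by blast

lemma triangle_imp_contains_copy:
  assumes abc: "a \<in> verts H" "b \<in> verts H" "c \<in> verts H"
    and E: "{a, b} \<in> edges H" "{a, c} \<in> edges H" "{b, c} \<in> edges H"
    and H: "simple_graph H"
  shows "contains_copy H (cycle_graph 3)"
proof -
  define f where "f i = (if i = 0 then a else if i = Suc 0 then b else c)" for i :: nat
  define G where "G = UGraph {a, b, c} {{a, b}, {b, c}, {c, a}}"
  have ne: "a \<noteq> b" "a \<noteq> c" "b \<noteq> c"
    using E H doubleton_in_nsets_2 unfolding simple_graph_def by (metis subsetD)+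
  have eq: "{..<3} = {0, 1, 2 :: nat}"
    by auto
  have "isomorphic (cycle_graph 3) G"
    unfolding isomorphic_def
    by (rule exI[of _ f])
      (use ne in \<open>auto simp: cycle_graph_def G_def eq f_def bij_betw_def inj_on_def\<close>)
  moreover have "subgraph G H"
    using abc E ne by (auto simp: subgraph_def G_def simple_graph_def insert_commute)
  ultimately show ?thesis
    unfolding contains_copy_def by blast
qed

lemma ex_num_triangle: "ex_num n (cycle_graph 3) = n\<^sup>2 div 4"
  unfolding ex_num_def
proof (rule Max_eqI)
  show "finite {card (edges H) | H :: nat ugraph.
     simple_graph H \<and> card (verts H) = n \<and> \<not> contains_copy H (cycle_graph 3)}"
    by (rule finite_edge_counts)
  obtain H :: "nat ugraph" where "simple_graph H" "card (verts H) = n"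
    "card (edges H) = n\<^sup>2 div 4" "\<not> contains_copy H (cycle_graph 3)"
    using bipartite_extremal_graph[of n] by (metis odd_numeral)
  then show "n\<^sup>2 div 4 \<in> {card (edges H) | H :: nat ugraph.
     simple_graph H \<and> card (verts H) = n \<and> \<not> contains_copy H (cycle_graph 3)}"
    by (metis (mono_tags, lifting) mem_Collect_eq)
next
  fix y assume "y \<in> {card (edges H) | H :: nat ugraph.
     simple_graph H \<and> card (verts H) = n \<and> \<not> contains_copy H (cycle_graph 3)}"
  then obtain H :: "nat ugraph" where H: "y = card (edges H)" "simple_graph H" "card (verts H) = n"
    "\<not> contains_copy H (cycle_graph 3)"
    by blast
  have "spanned (edges H) (verts H) = edges H" "\<forall>e\<in>edges H. card e = 2" "finite (verts H)"
    using H(2) by (auto simp: simple_graph_def nsets_def spanned_def)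
  then have "4 * y \<le> n\<^sup>2"
    using mantel[of "verts H" "edges H"] triangle_imp_contains_copy[of _ H] H by metis
  then show "y \<le> n\<^sup>2 div 4" by simp
qed

theorem proposition3:
  fixes k :: nat
  assumes "odd k" and "k \<ge> 5"
  shows "\<exists>N. \<forall>n\<ge>N.
    st_num n (cycle_graph k) = ex_num n (cycle_graph k) \<and>
    ex_num n (cycle_graph k) = ex_num n (complete_graph 3)"
proof (intro exI allI impI)
  fix n assume n: "75 * (k\<^sup>2 + 2 * k + 1) + 20 \<le> n"
  let ?ex = "{card (edges H) | H :: nat ugraph.
     simple_graph H \<and> card (verts H) = n \<and> \<not> contains_copy H (cycle_graph k)}"
  let ?st = "{card (edges H) | H :: nat ugraph.
     simple_graph H \<and> card (verts H) = n \<and>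
     (\<forall>F. subgraph F H \<and> card (verts F) = card (verts (cycle_graph k)) \<longrightarrow>
        \<not> contains_proper_copy F (cycle_graph k))}"
  have "?ex \<subseteq> ?st"
    using contains_copy_of_subgraph_proper by blast
  moreover have "n\<^sup>2 div 4 \<in> ?ex"
  proof -
    obtain H :: "nat ugraph" where "simple_graph H" "card (verts H) = n"
      "card (edges H) = n\<^sup>2 div 4" "\<not> contains_copy H (cycle_graph k)"
      using bipartite_extremal_graph[of n] \<open>odd k\<close> by metis
    then show ?thesis
      by (metis (mono_tags, lifting) mem_Collect_eq)
  qed
  moreover have "y \<le> n\<^sup>2 div 4" if "y \<in> ?st" for y
  proof -
    obtain H :: "nat ugraph" where H: "y = card (edges H)" "simple_graph H" "card (verts H) = n"
      "\<forall>F. subgraph F H \<and> card (verts F) = k \<longrightarrow> \<not> contains_proper_copy F (cycle_graph k)"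
      using \<open>y \<in> ?st\<close> by (auto simp: cycle_graph_def)
    then have "\<not> 4 * y > n\<^sup>2"
      using dense_imp_proper_copy_of_odd_cycle[OF H(2) assms] n by blast
    then show ?thesis by simp
  qed
  moreover have "finite ?ex" "finite ?st"
    by (rule finite_edge_counts)+
  ultimately have "st_num n (cycle_graph k) = n\<^sup>2 div 4" "ex_num n (cycle_graph k) = n\<^sup>2 div 4"
    unfolding st_num_def ex_num_def by (intro Max_eqI; blast)+
  then show "st_num n (cycle_graph k) = ex_num n (cycle_graph k) \<and>
    ex_num n (cycle_graph k) = ex_num n (complete_graph 3)"
    by (simp add: complete_graph_3_eq ex_num_triangle)
qed

end
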